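(* Let $p\in\{0,1\}^m$ and let $P(\lambda)=\det(\lambda I-T_p)$ be the characteristic polynomial of $p$. Then $P(\lambda)=\lambda^m+c_{m-1}\lambda^{m-1}+\cdots+c_1\lambda+c_0$ where, for each $1\le k\le m$, $c_{m-k}=(-1)^{wt(p[1..k])}$ if $k$ is a period of $p$, and $c_{m-k}=0$ otherwise.
   Context: Binary alphabet $\{0,1\}$; strings indexed from 1, $p[i..j]$ denotes a substring, $wt(s)$ is the number of 1's in $s$. $p$ is $k$-periodic ($1\le k\le m$) if $p[i]=p[i+k]$ for all $1\le i\le m-k$. The KMP automaton of $p$ has states $q_1,\dots,q_{m+1}$, initial state $q_1$, and transition function $\delta$: $\delta(q_{m+1},c)=q_{m+1}$; $\delta(q_m,p[m])=q_{m+1}$; otherwise, for $1\le i\le m$, $\delta(q_i,c)=q_{j}$ where $j-1$ is the largest length of a suffix of $p[1..i-1]c$ that is a prefix of $p$. (Thus after reading a string $s$ the automaton is in $q_{m+1}$ iff $p$ occurs in $s$, and otherwise in $q_i$ with $i-1$ the length of the longest suffix of $s$ that is a prefix of $p$.) The transition matrix $T_p$ is the $m\times m$ integer matrix whose $(j,i)$ entry ($1\le i,j\le m$) is $\sum_{c\in\{0,1\}:\ \delta(q_i,c)=q_j}(-1)^c$. The characteristic polynomial of $p$ is $\det(\lambda I-T_p)$. *)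

theory Defs
  imports "Jordan_Normal_Form.Char_Poly" "HOL-Library.Sublist"
begin

text \<open>Binary strings are Boolean lists, \<open>True\<close> being the letter 1. Strings are indexed from 1
  in the mathematics, so \<open>p[i]\<close> is \<open>p ! (i - 1)\<close> and \<open>p[1..k]\<close> is \<open>take k p\<close>.\<close>

definition wt :: "bool list \<Rightarrow> nat" where
  "wt s = count_list s True"

definition k_periodic :: "nat \<Rightarrow> bool list \<Rightarrow> bool" where
  "k_periodic k p \<longleftrightarrow> 1 \<le> k \<and> k \<le> length p \<and>
     (\<forall>i\<in>{1..length p - k}. p ! (i - 1) = p ! (i + k - 1))"

text \<open>The state \<open>q\<^sub>i\<close> is represented by its index \<open>i \<in> {1..length p + 1}\<close>.\<close>

definition kmp_delta :: "bool list \<Rightarrow> nat \<Rightarrow> bool \<Rightarrow> nat" where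
  "kmp_delta p i c =
     (let m = length p in
      if i = m + 1 then m + 1
      else if i = m \<and> c = p ! (m - 1) then m + 1
      else Max {length s | s. suffix s (take (i - 1) p @ [c]) \<and> prefix s p} + 1)"

text \<open>Matrices are indexed from 0, so position \<open>(j, i)\<close> belongs to the states \<open>q\<^sub>j\<^sub>+\<^sub>1\<close> and
  \<open>q\<^sub>i\<^sub>+\<^sub>1\<close>; the accepting state has neither a row nor a column.\<close>

definition transition_matrix :: "bool list \<Rightarrow> int mat" where
  "transition_matrix p = mat (length p) (length p)
     (\<lambda>(j, i). \<Sum>c\<in>{c. kmp_delta p (i + 1) c = j + 1}. (-1) ^ of_bool c)"

end

theory Submission
  imports Defs
begin

text \<open>Let \<open>L\<close> be the unitriangular matrix whose \<open>(j, i)\<close> entry records whether \<open>p[1..j]\<close> is a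
  suffix of \<open>p[1..i]\<close>, for \<open>0 \<le> i, j < m\<close>. A prefix \<open>p[1..j]\<close> is a suffix of a word \<open>w\<close> iff it is a
  suffix of the longest prefix of \<open>p\<close> that is a suffix of \<open>w\<close>. Hence, apart from the transition into
  the accepting state, the \<open>(j, i)\<close> entry of \<open>L T\<close> is the signed number of letters \<open>c\<close> such that \<open>p[1..j]\<close>
  is a suffix of \<open>p[1..i] c\<close>. This is \<open>0\<close> for \<open>j = 0\<close> and \<open>(-1)\<^bsup>p[j]\<^esup> L(j - 1, i)\<close> for \<open>j > 0\<close>. The
  missing accepting transition corrects the last column by the border indicator of \<open>p\<close>.
  So \<open>L T = D L\<close> for a scaled companion matrix \<open>D\<close> with the border indicator in the last column,
  and a border of length \<open>j\<close> is the same as a period \<open>m - j\<close>.\<close>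

section \<open>Determinants and similarity over a commutative ring\<close>

text \<open>Laplace expansion along the first row meets only columns 0 and \<open>n\<close>. The
  first minor has the same shape with \<open>s\<close> and \<open>d\<close> shifted by one, and the
  last one is triangular. The ring is arbitrary so that \<open>x\<close> can be the polynomial
  indeterminate.\<close>

lemma det_scaled_companion:
  fixes x :: "'a :: comm_ring_1"
  shows "det (mat n n (\<lambda>(i, j). (if i = j then x else 0) - (if i = Suc j then s i else 0)
      + (if Suc j = n then d i else 0)))
    = x ^ n + (\<Sum>i<n. d i * (\<Prod>l = Suc i..<n. s l) * x ^ i)"
proof (induction n arbitrary: s d)
  case 0
  show ?case by simp
next
  case (Suc n)
  define M where "M = mat (Suc n) (Suc n) (\<lambda>(i, j). (if i = j then x else 0)
      - (if i = Suc j then s i else 0) + (if Suc j = Suc n then d i else 0))"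
  have M: "M \<in> carrier_mat (Suc n) (Suc n)" by (simp add: M_def)
  show ?case
  \<comment> \<open>For \<open>n = 0\<close> the columns 0 and \<open>n\<close> coincide, and the
    single entry is \<open>x + d 0\<close>.\<close>
  proof (cases "n = 0")
    case True
    then show ?thesis
      using laplace_expansion_row[OF M, of 0] by (simp add: M_def cofactor_def mat_delete_def)
  next
    case False
    have first_row: "M $$ (0, j) = (if j = 0 then x else if j = n then d 0 else 0)"
      if "j < Suc n" for j
      using that False by (auto simp: M_def)
    have minor0: "mat_delete M 0 0 = mat n n (\<lambda>(i, j). (if i = j then x else 0)
        - (if i = Suc j then s (Suc i) else 0) + (if Suc j = n then d (Suc i) else 0))"
      using False by (intro eq_matI) (auto simp: mat_delete_def M_def)
    have minor_n: "det (mat_delete M 0 n) = (-1) ^ n * (\<Prod>l = Suc 0..<Suc n. s l)"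
    proof -
      have eq: "mat_delete M 0 n = mat n n (\<lambda>(i, j). (if Suc i = j then x else 0)
          - (if i = j then s (Suc i) else 0))" (is "_ = ?U")
        by (intro eq_matI) (auto simp: mat_delete_def M_def)
      have "det ?U = prod_list (diag_mat ?U)"
        by (rule det_upper_triangular[of _ n]) (auto simp: upper_triangular_def)
      also have "\<dots> = (\<Prod>i = 0..<n. - s (Suc i))"
        by (simp add: prod_list_diag_prod)
      also have "\<dots> = (-1) ^ n * (\<Prod>l = Suc 0..<Suc n. s l)"
        by (subst prod.shift_bounds_Suc_ivl) (simp add: prod_uminus)
      finally show ?thesis using eq by simp
    qed
    have "det M = (\<Sum>j<Suc n. M $$ (0, j) * cofactor M 0 j)"
      by (rule laplace_expansion_row[OF M]) simp
    also have "\<dots> = (\<Sum>j\<in>{0, n}. M $$ (0, j) * cofactor M 0 j)"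
      by (rule sum.mono_neutral_right) (auto simp: first_row)
    also have "\<dots> = x * det (mat_delete M 0 0) + d 0 * ((-1) ^ n * det (mat_delete M 0 n))"
      using False by (simp add: first_row cofactor_def)
    \<comment> \<open>The cofactor sign cancels the sign from the diagonal entries
      \<open>- s (Suc i)\<close>.\<close>
    also have "(-1) ^ n * det (mat_delete M 0 n) = (\<Prod>l = Suc 0..<Suc n. s l)"
      by (simp add: minor_n mult.assoc[symmetric] power_mult_distrib[symmetric])
    also have "det (mat_delete M 0 0)
      = x ^ n + (\<Sum>i<n. d (Suc i) * (\<Prod>l = Suc i..<n. s (Suc l)) * x ^ i)"
      unfolding minor0 by (rule Suc.IH)
    finally have "det M = x ^ Suc n
        + ((\<Sum>i<n. d (Suc i) * (\<Prod>l = Suc (Suc i)..<Suc n. s l) * x ^ Suc i)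
        + d 0 * (\<Prod>l = Suc 0..<Suc n. s l) * x ^ 0)"
      by (simp add: prod.shift_bounds_Suc_ivl[symmetric] algebra_simps sum_distrib_left
          del: prod.op_ivl_Suc)
    then show ?thesis
      unfolding M_def[symmetric] sum.lessThan_Suc_shift by (simp add: add.commute)
  qed
qed

text \<open>For \<open>s\<close> constantly 1 this is the companion matrix of the monic polynomial
  with lower coefficients \<open>d\<close>.\<close>

definition scaled_companion :: "nat \<Rightarrow> (nat \<Rightarrow> 'a) \<Rightarrow> (nat \<Rightarrow> 'a) \<Rightarrow> 'a :: comm_ring_1 mat" where
  "scaled_companion n s d = mat n n (\<lambda>(i, j).
     (if i = Suc j then s i else 0) - (if Suc j = n then d i else 0))"

lemma scaled_companion_carrier [simp]: "scaled_companion n s d \<in> carrier_mat n n"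
  by (simp add: scaled_companion_def)

lemma char_poly_scaled_companion:
  "char_poly (scaled_companion n s d)
    = monom 1 n + (\<Sum>i<n. monom (d i * (\<Prod>l = Suc i..<n. s l)) i)"
proof -
  have "char_poly_matrix (scaled_companion n s d) = mat n n (\<lambda>(i, j).
      (if i = j then [:0, 1:] else 0) - (if i = Suc j then [:s i:] else 0)
      + (if Suc j = n then [:d i:] else 0))"
    by (intro eq_matI) (auto simp: char_poly_matrix_def scaled_companion_def)
  then have "char_poly (scaled_companion n s d) = [:0, 1:] ^ n
      + (\<Sum>i<n. [:d i:] * (\<Prod>l = Suc i..<n. [:s l:]) * [:0, 1:] ^ i)"
    by (simp only: char_poly_def det_scaled_companion)
  moreover have "(\<Prod>l\<in>A. [:s l:]) = [:\<Prod>l\<in>A. s l:]" for A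
    by (induction A rule: infinite_finite_induct) (simp_all add: one_pCons)
  ultimately show ?thesis
    by (simp add: monom_altdef mult.commute)
qed

text \<open>Determinant 1 makes the adjugate a two-sided inverse, so integer matrices can be
  conjugated without passing to a field.\<close>

lemma similar_mat_if_unit_det:
  fixes A B L :: "'a :: comm_ring_1 mat"
  assumes A: "A \<in> carrier_mat n n" and B: "B \<in> carrier_mat n n" and L: "L \<in> carrier_mat n n"
    and det: "det L = 1" and comm: "L * A = B * L"
  shows "similar_mat A B"
proof (rule similar_matI)
  note adj = adj_mat[OF L]
  show "{A, B, adj_mat L, L} \<subseteq> carrier_mat n n" using A B L adj by simp
  show inv: "adj_mat L * L = 1\<^sub>m n" and "L * adj_mat L = 1\<^sub>m n"
    using adj det by auto
  have "A = adj_mat L * L * A" using inv A by simp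
  also have "\<dots> = adj_mat L * (B * L)" using adj(1) L A by (simp add: comm)
  also have "\<dots> = adj_mat L * B * L" using adj(1) L B by simp
  finally show "A = adj_mat L * B * L" .
qed

section \<open>Prefixes of the pattern as suffixes of the text read\<close>

text \<open>Of two suffixes of the same word, the shorter is a suffix of the longer; maximality of
  \<open>l\<close> settles which one is shorter.\<close>

lemma longest_prefix_suffix:
  fixes p w :: "'a list"
  defines "l \<equiv> Max {length s | s. suffix s w \<and> prefix s p}"
  shows "suffix (take l p) w" "l \<le> length w" "l \<le> length p"
    and "\<And>j. j \<le> length p \<Longrightarrow> suffix (take j p) w \<longleftrightarrow> suffix (take j p) (take l p)"
proof -
  let ?S = "{length s | s. suffix s w \<and> prefix s p}"
  have fin: "finite ?S"
    by (rule finite_subset[of _ "{..length p}"]) (auto dest: prefix_length_le)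
  have ne: "0 \<in> ?S" by (auto intro: exI[of _ "[]"])
  have "l \<in> ?S" unfolding l_def using fin ne by (intro Max_in) (auto simp only: empty_iff)
  then obtain s where s: "suffix s w" "prefix s p" "l = length s" by auto
  have take_l: "take l p = s" using s by (auto simp: prefix_def)
  show *: "suffix (take l p) w" using s take_l by simp
  show "l \<le> length w" "l \<le> length p"
    using s by (auto dest: suffix_length_le prefix_length_le)
  show "suffix (take j p) w \<longleftrightarrow> suffix (take j p) (take l p)" if j: "j \<le> length p" for j
  proof
    assume suf: "suffix (take j p) w"
    have "length (take j p) \<in> ?S" using suf take_is_prefix by blast
    then have "j \<le> l" unfolding l_def using fin j by (intro Max_ge) auto
    then show "suffix (take j p) (take l p)"
      using suffix_length_suffix[OF suf *] j by simp
  next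
    assume "suffix (take j p) (take l p)"
    then show "suffix (take j p) w" using * suffix_order.trans by blast
  qed
qed

lemma suffix_snoc_take:
  assumes "j < length p"
  shows "suffix (take (Suc j) p) (w @ [c]) \<longleftrightarrow> c = p ! j \<and> suffix (take j p) w"
  using assms by (auto simp: take_Suc_conv_app_nth)

text \<open>This is the unsigned contribution of the letter \<open>c\<close> to the
  \<open>(j, i)\<close> entry of \<open>L T\<close>. On the accepting transition the word read is
  \<open>p\<close> itself, so the two terms on the right cancel; otherwise
  \<open>longest_prefix_suffix\<close> applies.\<close>

lemma kmp_delta_suffix:
  assumes i: "i < length p" and j: "j \<le> length p"
  shows "(if kmp_delta p (i + 1) c \<le> length p
      then of_bool (suffix (take j p) (take (kmp_delta p (i + 1) c - 1) p)) else 0)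
    = of_bool (suffix (take j p) (take i p @ [c]))
      - (of_bool (Suc i = length p \<and> c = p ! i \<and> suffix (take j p) p) :: int)"
proof (cases "Suc i = length p \<and> c = p ! i")
  case True
  then have "length p - 1 = i" by linarith
  then have "kmp_delta p (i + 1) c = length p + 1" "take i p @ [c] = p"
    using True take_Suc_conv_app_nth[OF i] by (simp_all add: kmp_delta_def Let_def)
  then show ?thesis using True by simp
next
  case False
  define w where "w = take i p @ [c]"
  define l where "l = Max {length s | s. suffix s w \<and> prefix s p}"
  have delta: "kmp_delta p (i + 1) c = l + 1"
  proof -
    have "\<not> (i + 1 = length p \<and> c = p ! (length p - 1))" using False
      by (metis add_diff_cancel_right' Suc_eq_plus1)
    then show ?thesis
      using i by (simp only: kmp_delta_def Let_def l_def w_def if_False) simp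
  qed
  note l = longest_prefix_suffix[where w = w and p = p, folded l_def]
  \<comment> \<open>By length, \<open>l = length p\<close> would force \<open>w = p\<close>, which
    is the accepting transition excluded in this case.\<close>
  have "l \<noteq> length p"
  proof
    assume eq: "l = length p"
    then have len: "Suc i = length p" using l(2) i by (simp add: w_def)
    moreover have "w = p"
    proof -
      have "suffix p w" "length w = length p" using l(1) eq len by (simp_all add: w_def)
      then show ?thesis by (auto simp: suffix_def)
    qed
    ultimately show False using False i
      by (metis length_append_singleton nat.inject nth_append_length w_def)
  qed
  then have "l < length p" using l(3) by simp
  moreover have "\<not> (Suc i = length p \<and> c = p ! i \<and> suffix (take j p) p)"
    using False by blast
  ultimately show ?thesis
    unfolding delta l(4)[OF j, unfolded w_def] by simp
qed

section \<open>Conjugating the transition matrix to a scaled companion matrix\<close>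

definition border_mat :: "'a list \<Rightarrow> int mat" where
  "border_mat p = mat (length p) (length p) (\<lambda>(j, i). of_bool (suffix (take j p) (take i p)))"

lemma border_mat_carrier [simp]: "border_mat p \<in> carrier_mat (length p) (length p)"
  by (simp add: border_mat_def)

lemma det_border_mat: "det (border_mat p) = 1"
proof -
  have "\<not> suffix (take j p) (take i p)" if "i < j" "j < length p" for i j
    using that by (auto dest: suffix_length_le)
  then have "det (border_mat p) = prod_list (diag_mat (border_mat p))"
    by (intro det_upper_triangular[of _ "length p"])
      (auto simp: upper_triangular_def border_mat_def)
  also have "\<dots> = 1"
    by (simp add: prod_list_diag_prod border_mat_def)
  finally show ?thesis .
qed

definition letter_sign :: "bool \<Rightarrow> int" where
  "letter_sign c = (-1) ^ of_bool c"

text \<open>Lists are indexed from 0: row \<open>j\<close> carries the sign of \<open>p[j]\<close>, which is \<open>p ! (j - 1)\<close>.\<close>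

definition border_companion :: "bool list \<Rightarrow> int mat" where
  "border_companion p = scaled_companion (length p) (\<lambda>j. letter_sign (p ! (j - 1)))
     (\<lambda>j. letter_sign (last p) * of_bool (suffix (take j p) p))"

lemma border_companion_carrier [simp]:
  "border_companion p \<in> carrier_mat (length p) (length p)"
  by (simp add: border_companion_def)

lemma transition_matrix_carrier [simp]:
  "transition_matrix p \<in> carrier_mat (length p) (length p)"
  by (simp add: transition_matrix_def)

lemma border_mat_times_transition_matrix:
  "border_mat p * transition_matrix p = border_companion p * border_mat p"
proof (rule eq_matI)
  fix j i
  assume "j < dim_row (border_companion p * border_mat p)"
    and "i < dim_col (border_companion p * border_mat p)"
  then have j: "j < length p" and i: "i < length p"
    by (simp_all add: border_companion_def scaled_companion_def border_mat_def)
  let ?m = "length p"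
  let ?b = "\<lambda>j w. of_bool (suffix (take j p) w) :: int"
  let ?\<delta> = "kmp_delta p (i + 1)"
  have delta_pos: "?\<delta> c \<ge> 1" for c by (simp add: kmp_delta_def Let_def)
  have "(border_mat p * transition_matrix p) $$ (j, i)
      = (\<Sum>k<?m. ?b j (take k p) * (\<Sum>c\<in>{c. ?\<delta> c = k + 1}. letter_sign c))"
    using i j by (simp add: border_mat_def transition_matrix_def scalar_prod_def
        letter_sign_def atLeast0LessThan)
  also have "\<dots> = (\<Sum>k<?m. \<Sum>c\<in>UNIV.
      if ?\<delta> c = k + 1 then letter_sign c * ?b j (take k p) else 0)"
    by (intro sum.cong refl)
      (simp add: sum_distrib_left mult.commute sum.If_cases Collect_conj_eq)
  also have "\<dots> = (\<Sum>c\<in>UNIV. \<Sum>k<?m.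
      if ?\<delta> c = k + 1 then letter_sign c * ?b j (take k p) else 0)"
    by (rule sum.swap)
  \<comment> \<open>Each letter selects at most one \<open>k\<close>, and none if it leads to the
    accepting state. States start at 1, so the subtraction does not truncate.\<close>
  also have "\<dots> = (\<Sum>c\<in>UNIV. letter_sign c *
      (if ?\<delta> c \<le> ?m then ?b j (take (?\<delta> c - 1) p) else 0))"
  proof (intro sum.cong refl)
    fix c
    have "(\<Sum>k<?m. if ?\<delta> c = k + 1 then letter_sign c * ?b j (take k p) else 0)
        = (\<Sum>k<?m. if ?\<delta> c - 1 = k then letter_sign c * ?b j (take k p) else 0)"
      using delta_pos[of c] by (intro sum.cong refl if_cong) auto
    also have "\<dots> = letter_sign c * (if ?\<delta> c \<le> ?m then ?b j (take (?\<delta> c - 1) p) else 0)"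
      using delta_pos[of c] by auto
    finally show "(\<Sum>k<?m. if ?\<delta> c = k + 1 then letter_sign c * ?b j (take k p) else 0)
        = letter_sign c * (if ?\<delta> c \<le> ?m then ?b j (take (?\<delta> c - 1) p) else 0)" .
  qed
  also have "\<dots> = (\<Sum>c\<in>UNIV. letter_sign c *
      (?b j (take i p @ [c]) - of_bool (Suc i = ?m \<and> c = p ! i \<and> suffix (take j p) p)))"
    using i j by (simp only: kmp_delta_suffix less_imp_le)
  also have "\<dots> = (if j = 0 then 0 else letter_sign (p ! (j - 1)) * ?b (j - 1) (take i p))
      - (if Suc i = ?m then letter_sign (last p) * ?b j p else 0)"
  proof -
    \<comment> \<open>For \<open>j = 0\<close> both letters count and their signs cancel; for
      \<open>j > 0\<close> only \<open>c = p ! (j - 1)\<close> can contribute.\<close>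
    have letters: "(\<Sum>c\<in>UNIV. letter_sign c * ?b j (take i p @ [c]))
        = (if j = 0 then 0 else letter_sign (p ! (j - 1)) * ?b (j - 1) (take i p))"
      using j by (cases j; cases "p ! (j - 1)")
        (simp_all add: suffix_snoc_take UNIV_bool letter_sign_def del: suffix_snoc)
    have last: "(\<Sum>c\<in>UNIV. letter_sign c *
        of_bool (Suc i = ?m \<and> c = p ! i \<and> suffix (take j p) p))
        = (if Suc i = ?m then letter_sign (last p) * ?b j p else 0)"
    proof (cases "Suc i = ?m")
      case True
      then have "length p - 1 = i" by simp
      then have "last p = p ! i" using i by (subst last_conv_nth) auto
      then show ?thesis using True by (cases "p ! i") (simp_all add: UNIV_bool)
    qed simp
    show ?thesis by (simp only: right_diff_distrib sum_subtractf letters last)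
  qed
  also have "\<dots> = (\<Sum>k<?m. (if j = Suc k then letter_sign (p ! (j - 1)) else 0) * ?b k (take i p))
      - (\<Sum>k<?m. (if Suc k = ?m then letter_sign (last p) * ?b j p else 0) * ?b k (take i p))"
  proof -
    have "(\<Sum>k<?m. (if j = Suc k then letter_sign (p ! (j - 1)) else 0) * ?b k (take i p))
        = (if j = 0 then 0 else letter_sign (p ! (j - 1)) * ?b (j - 1) (take i p))"
    proof (cases j)
      case (Suc j')
      have "(\<Sum>k<?m. (if j = Suc k then letter_sign (p ! (j - 1)) else 0) * ?b k (take i p))
          = (\<Sum>k<?m. if j' = k then letter_sign (p ! (j - 1)) * ?b k (take i p) else 0)"
        by (intro sum.cong) (auto simp: Suc)
      then show ?thesis using Suc j by simp
    qed simp
    moreover have "(\<Sum>k<?m. (if Suc k = ?m then letter_sign (last p) * ?b j p else 0)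
          * ?b k (take i p))
        = (if Suc i = ?m then letter_sign (last p) * ?b j p else 0)"
    proof -
      \<comment> \<open>The last row of \<open>L\<close> is zero off the diagonal, so the last
        column of \<open>D\<close> affects only the last column of \<open>D L\<close>.\<close>
      have "suffix (take (?m - 1) p) (take i p) \<longleftrightarrow> Suc i = ?m"
      proof
        assume "suffix (take (?m - 1) p) (take i p)"
        from suffix_length_le[OF this] show "Suc i = ?m" using i by auto
      next
        assume "Suc i = ?m"
        then have "?m - 1 = i" by simp
        then show "suffix (take (?m - 1) p) (take i p)" by simp
      qed
      moreover have "(\<Sum>k<?m. (if Suc k = ?m then letter_sign (last p) * ?b j p else 0)
            * ?b k (take i p))
          = (\<Sum>k<?m. if ?m - 1 = k then letter_sign (last p) * ?b j p * ?b k (take i p) else 0)"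
        using i by (intro sum.cong) auto
      moreover have "?m - 1 < ?m" using i by linarith
      ultimately show ?thesis by simp
    qed
    ultimately show ?thesis by simp
  qed
  also have "\<dots> = (border_companion p * border_mat p) $$ (j, i)"
    using i j by (simp add: border_mat_def border_companion_def scaled_companion_def
        scalar_prod_def atLeast0LessThan left_diff_distrib sum_subtractf cong: if_cong)
  finally show "(border_mat p * transition_matrix p) $$ (j, i)
      = (border_companion p * border_mat p) $$ (j, i)" .
qed (simp_all add: border_mat_def transition_matrix_def border_companion_def scaled_companion_def)

section \<open>Borders, periods and the coefficients\<close>

lemma suffix_take_iff_drop:
  assumes "j \<le> length p"
  shows "suffix (take j p) p \<longleftrightarrow> drop (length p - j) p = take j p"
proof
  assume "suffix (take j p) p"
  then obtain q where q: "p = q @ take j p" by (auto simp: suffix_def)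
  then have "length q = length p - j" using assms
    by (metis diff_add_inverse2 length_append length_take min_absorb2)
  then show "drop (length p - j) p = take j p" using q by (metis append_eq_conv_conj)
next
  assume "drop (length p - j) p = take j p"
  then show "suffix (take j p) p" by (metis suffix_drop)
qed

lemma k_periodic_iff_border:
  assumes "1 \<le> k" "k \<le> length p"
  shows "k_periodic k p \<longleftrightarrow> drop k p = take (length p - k) p"
proof -
  have "drop k p = take (length p - k) p \<longleftrightarrow> (\<forall>i<length p - k. p ! (k + i) = p ! i)"
    using assms by (simp add: list_eq_iff_nth_eq)
  also have "\<dots> \<longleftrightarrow> (\<forall>i\<in>{1..length p - k}. p ! (i - 1) = p ! (i + k - 1))"
  proof
    assume L: "\<forall>i<length p - k. p ! (k + i) = p ! i"
    show "\<forall>i\<in>{1..length p - k}. p ! (i - 1) = p ! (i + k - 1)"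
    proof
      fix i assume "i \<in> {1..length p - k}"
      then show "p ! (i - 1) = p ! (i + k - 1)"
        using L[rule_format, of "i - 1"] by (auto simp: add.commute)
    qed
  next
    assume R: "\<forall>i\<in>{1..length p - k}. p ! (i - 1) = p ! (i + k - 1)"
    show "\<forall>i<length p - k. p ! (k + i) = p ! i"
      using R by (auto dest!: bspec[of _ _ "Suc _"] simp: add.commute)
  qed
  finally show ?thesis using assms by (simp add: k_periodic_def)
qed

lemma prod_letter_sign: "(\<Prod>l<length s. letter_sign (s ! l)) = (-1) ^ wt s"
proof (induction s)
  case (Cons c s)
  then show ?case
    by (simp add: prod.lessThan_Suc_shift wt_def letter_sign_def del: prod.lessThan_Suc)
qed (simp add: wt_def)

theorem theorem5:
  fixes p :: "bool list" and m :: nat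
  assumes "length p = m"
  shows "char_poly (transition_matrix p) =
    monom 1 m +
    (\<Sum>k = 1..m. monom (if k_periodic k p then (-1) ^ wt (take k p) else 0) (m - k))"
proof -
  \<comment> \<open>The coefficient at degree \<open>i\<close> of the companion matrix. The product
    covers all but the final letter of \<open>drop i p\<close>, and \<open>last p\<close> supplies
    that one.\<close>
  let ?a = "\<lambda>i. letter_sign (last p) * of_bool (suffix (take i p) p)
    * (\<Prod>l = Suc i..<m. letter_sign (p ! (l - 1)))"
  have coeff: "?a (m - k) = (if k_periodic k p then (-1) ^ wt (take k p) else 0)"
    if k: "k \<in> {1..m}" for k
  proof -
    have per: "suffix (take (m - k) p) p \<longleftrightarrow> k_periodic k p"
      using k assms by (simp add: suffix_take_iff_drop k_periodic_iff_border)
    have "letter_sign (last p) * (\<Prod>l = Suc (m - k)..<m. letter_sign (p ! (l - 1)))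
        = (-1) ^ wt (take k p)" if "k_periodic k p"
    proof -
      \<comment> \<open>The coefficient carries the sign of the last \<open>k\<close> letters, the
        claim that of the first \<open>k\<close>. By periodicity
        \<open>drop k p = take (m - k) p\<close>, so removing either block from \<open>p\<close>
        leaves a word of the same weight, and the two signs agree.\<close>
      have split: "wt p = wt (take k p) + wt (take (m - k) p)"
        using that k assms k_periodic_iff_border[of k p]
        by (metis append_take_drop_id atLeastAtMost_iff count_list_append wt_def)
      obtain n where n: "m = Suc n" using k by (cases m) auto
      have "letter_sign (last p) * (\<Prod>l = Suc (m - k)..<m. letter_sign (p ! (l - 1)))
          = (\<Prod>l = m - k..<m. letter_sign (p ! l))"
      proof -
        have "last p = p ! n" using n assms by (subst last_conv_nth) auto
        moreover have "m - k \<le> n" using n k by auto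
        ultimately show ?thesis
          by (simp only: n prod.shift_bounds_Suc_ivl) (simp add: mult.commute)
      qed
      moreover have "(\<Prod>l<m - k. letter_sign (p ! l)) * (\<Prod>l = m - k..<m. letter_sign (p ! l))
          = (\<Prod>l<m. letter_sign (p ! l))"
        by (simp add: prod.atLeastLessThan_concat lessThan_atLeast0)
      moreover have "(\<Prod>l<m - k. letter_sign (p ! l)) = (-1) ^ wt (take (m - k) p)"
        using prod_letter_sign[of "take (m - k) p"] assms by simp
      moreover have "(\<Prod>l<m. letter_sign (p ! l)) = (-1) ^ wt p"
        using prod_letter_sign[of p] assms by simp
      ultimately show ?thesis
        by (simp add: split power_add)
    qed
    then show ?thesis by (simp add: per)
  qed
  have "similar_mat (transition_matrix p) (border_companion p)"
    by (rule similar_mat_if_unit_det[OF _ _ border_mat_carrier det_border_mat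
          border_mat_times_transition_matrix]) simp_all
  then have "char_poly (transition_matrix p) = monom 1 m + (\<Sum>i<m. monom (?a i) i)"
    by (simp add: char_poly_similar border_companion_def char_poly_scaled_companion assms)
  also have "(\<Sum>i<m. monom (?a i) i) = (\<Sum>k = 1..m. monom (?a (m - k)) (m - k))"
    by (rule sum.reindex_bij_witness[of _ "\<lambda>k. m - k" "\<lambda>i. m - i"]) auto
  also have "\<dots> = (\<Sum>k = 1..m. monom (if k_periodic k p then (-1) ^ wt (take k p) else 0) (m - k))"
    using coeff by (intro sum.cong refl) simp
  finally show ?thesis .
qed

end
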